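(* Let $P$ be a finite lattice and let $M=\mathcal{F}(P)$ be the monoid of all regressive, order-preserving, $1$-level-Lipschitz functions $f:P\to P$, under function composition (with $(fg)(p)=f(g(p))$). Then $X(M)$ is linear if and only if $P$ is a chain of length $1$, $2$ or $3$.
   Context: A function $f:P\to P$ on a poset is regressive if $f(p)\leq p$ for all $p\in P$, and order-preserving if $x\leq y$ implies $f(x)\leq f(y)$. The length of a chain is its number of elements. For $x$ in a finite poset $P$, $\operatorname{level}(x)$ is the maximal length of a chain in $P$ whose maximal element is $x$ (so minimal elements have level $1$). A function $f:P\to P$ is $k$-level-Lipschitz if whenever $x>y$ and $\operatorname{level}(x)=\operatorname{level}(y)+1$, then $|\operatorname{level}(f(x))-\operatorname{level}(f(y))|\leq k$. Finite lattices are nonempty (they have a minimum and a maximum). For a monoid $M$ and $m\in M$, put $mM=\{mx : x\in M\}$. $X(M)=\{mM : m\in M\}$ is viewed as a poset ordered by inclusion; it is linear if any two of its elements are comparable under $\subseteq$. Product convention: $(fg)(p)=f(g(p))$, so $fM=\{f\circ h : h\in M\}$. *)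

theory Defs
  imports "HOL-Algebra.Group"
begin

definition regressive :: "('a::order \<Rightarrow> 'a) \<Rightarrow> bool" where
  "regressive f \<longleftrightarrow> (\<forall>p. f p \<le> p)"

text \<open>The length of a chain is its number of elements. The set below is finite and contains 1
  (from the chain \<open>{x}\<close>), so \<open>Max\<close> is meaningful.\<close>

definition level :: "'a::{finite, order} \<Rightarrow> nat" where
  "level x = Max {card C |C. Complete_Partial_Order.chain (\<le>) C \<and> x \<in> C \<and> (\<forall>y\<in>C. y \<le> x)}"

definition level_Lipschitz :: "nat \<Rightarrow> ('a::{finite, order} \<Rightarrow> 'a) \<Rightarrow> bool" where
  "level_Lipschitz k f \<longleftrightarrow>
    (\<forall>x y. x > y \<and> level x = level y + 1 \<longrightarrow>
      \<bar>int (level (f x)) - int (level (f y))\<bar> \<le> int k)"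

definition F_monoid :: "('a::{finite, order} \<Rightarrow> 'a) monoid" where
  "F_monoid = \<lparr>carrier = {f. regressive f \<and> mono f \<and> level_Lipschitz 1 f},
               mult = (\<circ>), one = id\<rparr>"

definition principal_right :: "('m, 'r) monoid_scheme \<Rightarrow> 'm \<Rightarrow> 'm set" where
  "principal_right M m = {m \<otimes>\<^bsub>M\<^esub> x |x. x \<in> carrier M}"

definition X_poset :: "('m, 'r) monoid_scheme \<Rightarrow> 'm set set" where
  "X_poset M = {principal_right M m |m. m \<in> carrier M}"

lemma level_strict_mono:
  fixes x y :: "'a::{finite, order}"
  assumes "y < x"
  shows "level y < level x"
proof -
  let ?S = "\<lambda>x::'a. {card C |C. Complete_Partial_Order.chain (\<le>) C \<and> x \<in> C \<and> (\<forall>y\<in>C. y \<le> x)}"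
  have fin: "finite (?S z)" for z
    by (rule finite_subset[of _ "card ` UNIV"]) auto
  have "card {y} \<in> ?S y"
    by (auto simp: Complete_Partial_Order.chain_def intro!: exI[of _ "{y}"])
  then have "level y \<in> ?S y"
    unfolding level_def using Max_in[OF fin] by blast
  then obtain C where C: "level y = card C" "Complete_Partial_Order.chain (\<le>) C"
      "y \<in> C" "\<forall>z\<in>C. z \<le> y"
    by blast
  have le: "z \<le> x" if "z \<in> C" for z
    using C(4) that assms by (meson order.trans order.strict_implies_order)
  have "x \<notin> C" using C(4) assms by (meson leD)
  then have "card (insert x C) = Suc (level y)" using C(1) by simp
  moreover have "Complete_Partial_Order.chain (\<le>) (insert x C)"
    using C(2) le by (auto simp: Complete_Partial_Order.chain_def)
  ultimately have "Suc (level y) \<in> ?S x"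
    using le by (intro CollectI exI[of _ "insert x C"]) auto
  then show ?thesis
    unfolding level_def[of x] using Max_ge[OF fin] by (meson Suc_le_lessD)
qed

lemma monoid_F_monoid: "Group.monoid (F_monoid :: ('a::{finite, order} \<Rightarrow> 'a) monoid)"
proof
  fix f g :: "'a \<Rightarrow> 'a"
  assume "f \<in> carrier F_monoid" "g \<in> carrier F_monoid"
  then have f: "regressive f" "mono f" "level_Lipschitz 1 f"
    and g: "regressive g" "mono g" "level_Lipschitz 1 g"
    by (auto simp: F_monoid_def)
  have "regressive (f \<circ> g)"
    using f(1) g(1) by (auto simp: regressive_def intro: order_trans)
  moreover have "mono (f \<circ> g)"
    using f(2) g(2) by (auto simp: mono_def)
  moreover have "level_Lipschitz 1 (f \<circ> g)"
    unfolding level_Lipschitz_def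
  proof (intro allI impI)
    fix x y :: 'a
    assume xy: "x > y \<and> level x = level y + 1"
    then have "g y \<le> g x" using g(2) by (auto simp: mono_def)
    moreover have "\<bar>int (level (g x)) - int (level (g y))\<bar> \<le> 1"
      using g(3) xy by (auto simp: level_Lipschitz_def)
    ultimately have "g y = g x \<or> (g x > g y \<and> level (g x) = level (g y) + 1)"
      using level_strict_mono[of "g y" "g x"] by (auto simp: order.order_iff_strict)
    then show "\<bar>int (level ((f \<circ> g) x)) - int (level ((f \<circ> g) y))\<bar> \<le> int 1"
      using f(3) by (auto simp: level_Lipschitz_def)
  qed
  ultimately show "f \<otimes>\<^bsub>F_monoid\<^esub> g \<in> carrier F_monoid"
    by (simp add: F_monoid_def)
qed (auto simp: F_monoid_def regressive_def mono_def level_Lipschitz_def)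

end

theory Submission
  imports Defs
begin

text \<open>
  Linearity of \<open>X(M)\<close> means that of any two \<open>f, g \<in> M\<close> one lies in the principal right ideal of the
  other. Membership \<open>f \<in> gM\<close> forces the image of \<open>f\<close> into the image of \<open>g\<close> and, as all maps are
  regressive, the fixed points of \<open>f\<close> into the fixed points of \<open>g\<close>.

  If \<open>P\<close> is not a chain, let \<open>w\<close> be minimal among the elements with two distinct upper covers \<open>b\<close> and
  \<open>b'\<close>. Minimality makes every element comparable to \<open>w\<close>, so \<open>x \<mapsto> x \<sqinter> b\<close> and \<open>x \<mapsto> x \<sqinter> b'\<close> are
  \<open>1\<close>-level-Lipschitz; their images are the incomparable principal ideals below \<open>b\<close> and \<open>b'\<close>.

  If \<open>P\<close> is a chain containing \<open>p < q < r < s\<close>, the predecessor map is incomparable with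
  \<open>x \<mapsto> x \<sqinter> q\<close>: it sends \<open>s\<close> above \<open>q\<close>, but it does not fix \<open>q\<close>.

  On a chain the Lipschitz condition makes the fixed points of each \<open>f \<in> M\<close> a lower set, so the fixed
  points of \<open>f\<close> and \<open>g\<close> are nested, say those of \<open>f\<close> are fixed by \<open>g\<close>. Then \<open>g \<circ> f = f\<close>, unless
  \<open>g (f x) < f x < x\<close> for some \<open>x\<close>; with at most three elements these three points are all of \<open>P\<close>,
  which leaves \<open>f = g\<close> or \<open>f \<circ> g = g\<close>.
\<close>

lemma (in Group.monoid) principal_right_self:
  "m \<in> carrier G \<Longrightarrow> m \<in> principal_right G m"
  by (auto simp: principal_right_def intro!: exI[of _ "\<one>"])

lemma (in Group.monoid) principal_right_subset_iff:
  assumes "m \<in> carrier G" "n \<in> carrier G"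
  shows "principal_right G m \<subseteq> principal_right G n \<longleftrightarrow> m \<in> principal_right G n"
proof
  assume "principal_right G m \<subseteq> principal_right G n"
  then show "m \<in> principal_right G n" using principal_right_self[OF assms(1)] by blast
next
  assume "m \<in> principal_right G n"
  then obtain x where "x \<in> carrier G" "m = n \<otimes> x"
    by (auto simp: principal_right_def)
  then show "principal_right G m \<subseteq> principal_right G n"
    using assms by (auto simp: principal_right_def m_assoc)
qed

lemma (in Group.monoid) chain_X_poset_iff:
  "Complete_Partial_Order.chain (\<subseteq>) (X_poset G) \<longleftrightarrow>
    (\<forall>m\<in>carrier G. \<forall>n\<in>carrier G. m \<in> principal_right G n \<or> n \<in> principal_right G m)"
proof -
  have "Complete_Partial_Order.chain (\<subseteq>) (X_poset G) \<longleftrightarrow>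
    (\<forall>m\<in>carrier G. \<forall>n\<in>carrier G. principal_right G m \<subseteq> principal_right G n \<or>
      principal_right G n \<subseteq> principal_right G m)"
    by (auto simp: X_poset_def Complete_Partial_Order.chain_def)
  then show ?thesis by (simp add: principal_right_subset_iff)
qed

lemma card_le_level:
  fixes x :: "'a::{finite, order}"
  assumes "Complete_Partial_Order.chain (\<le>) C" "x \<in> C" "\<And>y. y \<in> C \<Longrightarrow> y \<le> x"
  shows "card C \<le> level x"
  unfolding level_def using assms by (intro Max_ge) auto

lemma level_eq_card_chain:
  fixes x :: "'a::{finite, order}"
  obtains C where "Complete_Partial_Order.chain (\<le>) C" "x \<in> C" "\<And>y. y \<in> C \<Longrightarrow> y \<le> x"
    "card C = level x"
proof -
  let ?S = "{card C |C. Complete_Partial_Order.chain (\<le>) C \<and> x \<in> C \<and> (\<forall>y\<in>C. y \<le> x)}"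
  have "card {x} \<in> ?S"
    by (auto simp: Complete_Partial_Order.chain_def intro!: exI[of _ "{x}"])
  then have "Max ?S \<in> ?S" by (intro Max_in) auto
  then show thesis using that unfolding level_def by auto
qed

lemma level_le_Suc_level:
  fixes b w :: "'a::{finite, order}"
  assumes "\<And>z. z < b \<Longrightarrow> z \<le> w"
  shows "level b \<le> level w + 1"
proof -
  obtain C where C: "Complete_Partial_Order.chain (\<le>) C" "b \<in> C" "\<And>z. z \<in> C \<Longrightarrow> z \<le> b"
    and card_C: "card C = level b"
    by (rule level_eq_card_chain[of b]) blast
  let ?D = "insert w (C - {b})"
  have below_w: "z \<le> w" if "z \<in> C - {b}" for z
    using that C(3) assms by (auto simp: order.order_iff_strict)
  then have "Complete_Partial_Order.chain (\<le>) ?D"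
    using C(1) by (auto simp: Complete_Partial_Order.chain_def)
  then have "card ?D \<le> level w"
    using below_w by (intro card_le_level) auto
  moreover have "card (C - {b}) \<le> card ?D" by (intro card_mono) auto
  ultimately show ?thesis using C(2) card_C by simp
qed

lemma mono_level: "mono (level :: 'a::{finite, order} \<Rightarrow> nat)"
  by (rule monoI) (metis level_strict_mono order.order_iff_strict)

lemma carrier_F_monoid_iff:
  fixes f :: "'a::{finite, order} \<Rightarrow> 'a"
  shows "f \<in> carrier F_monoid \<longleftrightarrow> regressive f \<and> mono f \<and>
    (\<forall>x y. y < x \<longrightarrow> level x = level y + 1 \<longrightarrow> level (f x) \<le> level (f y) + 1)"
proof -
  have "level (f y) \<le> level (f x)" if "mono f" "y < x" for x y
    using that by (simp add: monoD mono_level)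
  then show ?thesis
    unfolding F_monoid_def level_Lipschitz_def by fastforce
qed

lemma F_monoid_le: "f \<in> carrier F_monoid \<Longrightarrow> f x \<le> x"
  by (simp add: carrier_F_monoid_iff regressive_def)

lemma principal_right_F_monoid_iff:
  "f \<in> principal_right F_monoid g \<longleftrightarrow> (\<exists>h\<in>carrier F_monoid. f = g \<circ> h)"
  by (auto simp: principal_right_def F_monoid_def)

lemma principal_right_F_monoid_absorb:
  assumes "f \<in> carrier F_monoid" "g \<circ> f = f"
  shows "f \<in> principal_right F_monoid g"
  unfolding principal_right_F_monoid_iff using assms by (intro bexI[of _ f]) simp_all

lemma principal_right_F_monoid_fixed_point:
  assumes "f \<in> principal_right F_monoid g" "g \<in> carrier F_monoid" "f x = x"
  shows "g x = x"
proof -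
  obtain h where h: "h \<in> carrier F_monoid" "f = g \<circ> h"
    using assms(1) by (auto simp: principal_right_F_monoid_iff)
  then have "x \<le> h x"
    using F_monoid_le[OF assms(2), of "h x"] assms(3) by simp
  then have "h x = x"
    using F_monoid_le[OF h(1), of x] by simp
  then show ?thesis using h(2) assms(3) by simp
qed

definition covered_by :: "'a::order \<Rightarrow> 'a \<Rightarrow> bool" where
  "covered_by w b \<longleftrightarrow> w < b \<and> (\<forall>z. w < z \<longrightarrow> z \<le> b \<longrightarrow> z = b)"

lemma covered_by_exists:
  fixes w x :: "'a::{finite, order}"
  assumes "w < x"
  obtains b where "covered_by w b" "b \<le> x"
proof -
  obtain b where "b \<in> {c. w < c \<and> c \<le> x}" "\<forall>c\<in>{c. w < c \<and> c \<le> x}. c \<le> b \<longrightarrow> b = c"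
    using finite_has_minimal[of "{c. w < c \<and> c \<le> x}"] assms by auto
  then have "covered_by w b" "b \<le> x"
    by (auto simp: covered_by_def intro: order_trans)
  then show thesis by (rule that)
qed

lemma inf_two_covers:
  fixes x y :: "'a::{finite, lattice}"
  assumes "\<not> x \<le> y" "\<not> y \<le> x"
  shows "\<exists>b b'. covered_by (inf x y) b \<and> covered_by (inf x y) b' \<and> b \<noteq> b'"
proof -
  have "inf x y < x" "inf x y < y"
    using assms by (metis inf.cobounded1 inf.cobounded2 order.not_eq_order_implies_strict)+
  then obtain b b' where b: "covered_by (inf x y) b" "b \<le> x"
    and b': "covered_by (inf x y) b'" "b' \<le> y"
    by (meson covered_by_exists)
  have "b \<noteq> b'"
    using b b' by (metis covered_by_def le_inf_iff leD)
  then show ?thesis using b b' by blast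
qed

lemma inf_cover_in_F_monoid:
  fixes w b :: "'a::{finite, lattice}"
  assumes comparable: "\<And>x. x \<le> w \<or> w \<le> x" and cover: "covered_by w b"
  shows "(\<lambda>x. inf x b) \<in> carrier F_monoid"
proof -
  have "w < b" using cover by (simp add: covered_by_def)
  have "z \<le> w" if "z < b" for z
    using that comparable[of z] cover by (auto simp: covered_by_def order.order_iff_strict)
  then have level_b: "level b \<le> level w + 1" by (rule level_le_Suc_level)
  have "level (inf x b) \<le> level (inf y b) + 1" if "y < x" "level x = level y + 1" for x y
    using comparable[of y]
  proof
    assume "y \<le> w"
    then have "inf y b = y" using \<open>w < b\<close> by (simp add: inf_absorb1)
    moreover have "level (inf x b) \<le> level x" by (simp add: monoD[OF mono_level])
    ultimately show ?thesis using that(2) by simp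
  next
    assume "w \<le> y"
    then have "level w \<le> level (inf y b)"
      using \<open>w < b\<close> by (intro monoD[OF mono_level]) simp
    moreover have "level (inf x b) \<le> level b" by (simp add: monoD[OF mono_level])
    ultimately show ?thesis using level_b by simp
  qed
  moreover have "mono (\<lambda>x. inf x b)"
    by (auto intro: monoI inf_mono)
  ultimately show ?thesis
    by (simp add: carrier_F_monoid_iff regressive_def)
qed

lemma principal_right_inf_le:
  fixes f :: "'a::{finite, lattice} \<Rightarrow> 'a"
  assumes "f \<in> principal_right F_monoid (\<lambda>x. inf x c)"
  shows "f x \<le> c"
  using assms by (auto simp: principal_right_F_monoid_iff)

lemma minimal_branching_element:
  assumes "\<not> Complete_Partial_Order.chain (\<le>) (UNIV :: 'a::{finite, lattice} set)"
  obtains w b b' :: "'a::{finite, lattice}"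
    where "\<And>x. x \<le> w \<or> w \<le> x" "covered_by w b" "covered_by w b'" "b \<noteq> b'"
proof -
  let ?W = "{w::'a. \<exists>b b'. covered_by w b \<and> covered_by w b' \<and> b \<noteq> b'}"
  have "?W \<noteq> {}"
    using assms inf_two_covers by (force simp: Complete_Partial_Order.chain_def)
  then obtain w where w: "w \<in> ?W" and minimal: "\<forall>v\<in>?W. v \<le> w \<longrightarrow> w = v"
    using finite_has_minimal[OF finite[of ?W]] by blast
  have "x \<le> w \<or> w \<le> x" for x
  proof (rule ccontr)
    assume incomparable: "\<not> (x \<le> w \<or> w \<le> x)"
    then have "inf x w \<in> ?W" using inf_two_covers[of x w] by simp
    then have "w = inf x w" using minimal by simp
    then show False using incomparable inf.cobounded1[of x w] by simp
  qed
  then show thesis using w that by blast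
qed

lemma chain_X_poset_imp_chain:
  assumes "Complete_Partial_Order.chain (\<subseteq>)
    (X_poset (F_monoid :: ('a::{finite, lattice} \<Rightarrow> 'a) monoid))"
  shows "Complete_Partial_Order.chain (\<le>) (UNIV :: 'a set)"
proof (rule ccontr)
  assume "\<not> ?thesis"
  then obtain w b b' :: 'a where comparable: "\<And>x. x \<le> w \<or> w \<le> x"
    and covers: "covered_by w b" "covered_by w b'" and "b \<noteq> b'"
    by (rule minimal_branching_element) blast
  have "(\<lambda>x. inf x b) \<in> carrier F_monoid" "(\<lambda>x. inf x b') \<in> carrier F_monoid"
    using comparable covers by (intro inf_cover_in_F_monoid[of w]; simp)+
  then consider "(\<lambda>x. inf x b) \<in> principal_right F_monoid (\<lambda>x. inf x b')"
    | "(\<lambda>x. inf x b') \<in> principal_right F_monoid (\<lambda>x. inf x b)"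
    using assms monoid.chain_X_poset_iff[OF monoid_F_monoid] by blast
  then have "b \<le> b' \<or> b' \<le> b"
    by cases (use principal_right_inf_le[of "\<lambda>x. inf x b" b' b]
      principal_right_inf_le[of "\<lambda>x. inf x b'" b b'] in simp_all)
  then show False
    using covers \<open>b \<noteq> b'\<close> by (auto simp: covered_by_def)
qed

definition predecessor :: "'a::{finite, lattice} \<Rightarrow> 'a" where
  "predecessor x = (if {..<x} = {} then x else Sup_fin {..<x})"

lemma le_predecessor: "y < x \<Longrightarrow> y \<le> predecessor x"
  by (auto simp: predecessor_def intro: Sup_fin.coboundedI)

lemma predecessor_le: "predecessor x \<le> x"
  by (auto simp: predecessor_def intro: Sup_fin.boundedI)

lemma mono_predecessor: "mono predecessor"
proof (rule monoI)
  fix x y :: 'a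
  assume "x \<le> y"
  then show "predecessor x \<le> predecessor y"
    by (metis le_predecessor predecessor_le order.order_iff_strict order.trans)
qed

lemma level_le_Suc_level_predecessor: "level x \<le> level (predecessor x) + 1"
  by (intro level_le_Suc_level le_predecessor)

lemma predecessor_less:
  assumes "Complete_Partial_Order.chain (\<le>) (UNIV :: 'a::{finite, lattice} set)" "y < (x :: 'a)"
  shows "predecessor x < x"
proof -
  have "sup u v \<in> {u, v}" for u v :: 'a
    using Complete_Partial_Order.chainD[OF assms(1), of u v]
    by (auto simp: sup.absorb1 sup.absorb2)
  then have "Sup_fin {..<x} \<in> {..<x}"
    using assms(2) by (intro Sup_fin.closed) auto
  then show ?thesis using assms(2) by (auto simp: predecessor_def)
qed

lemma predecessor_covered_by:
  assumes "Complete_Partial_Order.chain (\<le>) (UNIV :: 'a::{finite, lattice} set)" "y < (x :: 'a)"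
  shows "covered_by (predecessor x) x"
  using predecessor_less[OF assms]
  by (auto simp: covered_by_def order.order_iff_strict dest: le_predecessor leD)

lemma level_predecessor:
  assumes "Complete_Partial_Order.chain (\<le>) (UNIV :: 'a::{finite, lattice} set)" "y < (x :: 'a)"
  shows "level x = level (predecessor x) + 1"
  using level_le_Suc_level_predecessor[of x] level_strict_mono[OF predecessor_less[OF assms]]
  by simp

lemma predecessor_in_F_monoid:
  assumes chain: "Complete_Partial_Order.chain (\<le>) (UNIV :: 'a::{finite, lattice} set)"
  shows "(predecessor :: 'a \<Rightarrow> 'a) \<in> carrier F_monoid"
proof -
  have "level (predecessor x) \<le> level (predecessor y) + 1"
    if "y < x" "level x = level y + 1" for x y :: 'a
    using that level_predecessor[OF chain that(1)] level_le_Suc_level_predecessor[of y] by simp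
  then show ?thesis
    by (simp add: carrier_F_monoid_iff regressive_def predecessor_le mono_predecessor)
qed

lemma chain_X_poset_imp_no_four_chain:
  fixes p q r s :: "'a::{finite, lattice}"
  assumes linear: "Complete_Partial_Order.chain (\<subseteq>) (X_poset (F_monoid :: ('a \<Rightarrow> 'a) monoid))"
  shows "\<not> (p < q \<and> q < r \<and> r < s)"
proof
  assume less: "p < q \<and> q < r \<and> r < s"
  let ?meet = "\<lambda>x. inf x q"
  note chain = chain_X_poset_imp_chain[OF linear]
  note predecessor_carrier = predecessor_in_F_monoid[OF chain]
  have "covered_by (predecessor q) q"
    using predecessor_covered_by[OF chain] less by blast
  then have "?meet \<in> carrier F_monoid"
    using chain by (intro inf_cover_in_F_monoid) (auto simp: Complete_Partial_Order.chain_def)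
  then consider (meet) "?meet \<in> principal_right F_monoid predecessor"
    | (predecessor) "predecessor \<in> principal_right F_monoid ?meet"
    using linear predecessor_carrier monoid.chain_X_poset_iff[OF monoid_F_monoid] by blast
  then show False
  proof cases
    case meet
    then have "predecessor q = q"
      using predecessor_carrier by (rule principal_right_F_monoid_fixed_point) simp
    then show False using predecessor_less[OF chain] less by force
  next
    case predecessor
    then have "predecessor s \<le> q" by (rule principal_right_inf_le)
    moreover have "r \<le> predecessor s" using less by (simp add: le_predecessor)
    ultimately show False using less by auto
  qed
qed

lemma chain_X_poset_imp_card_le_3:
  assumes linear: "Complete_Partial_Order.chain (\<subseteq>)
    (X_poset (F_monoid :: ('a::{finite, lattice} \<Rightarrow> 'a) monoid))"
  shows "card (UNIV :: 'a set) \<le> 3"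
proof -
  define t :: 'a where "t = Sup_fin UNIV"
  define b where "b = predecessor t"
  define a where "a = predecessor b"
  note chain = chain_X_poset_imp_chain[OF linear]
  have "z \<in> {a, b, t}" for z
  proof (rule ccontr)
    assume "z \<notin> {a, b, t}"
    moreover have "z \<le> t" by (simp add: t_def Sup_fin.coboundedI)
    ultimately have "z < t" "z < b" "z < a"
      using le_predecessor[of z t] le_predecessor[of z b]
      by (auto simp: a_def b_def order.order_iff_strict)
    then show False
      using chain_X_poset_imp_no_four_chain[OF linear, of z a b t] predecessor_less[OF chain]
      by (auto simp: a_def b_def)
  qed
  then have "card (UNIV :: 'a set) \<le> card {a, b, t}" by (intro card_mono) auto
  also have "\<dots> \<le> 3" by (simp add: card_insert_if)
  finally show ?thesis .
qed

lemma F_monoid_fixed_points_downward_closed: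
  fixes f :: "'a::{finite, lattice} \<Rightarrow> 'a"
  assumes chain: "Complete_Partial_Order.chain (\<le>) (UNIV :: 'a set)"
    and f: "f \<in> carrier F_monoid" and "f x = x" "y \<le> x"
  shows "f y = y"
  using \<open>f x = x\<close> \<open>y \<le> x\<close>
proof (induction "level x" arbitrary: x rule: less_induct)
  case less
  show ?case
  proof (cases "y = x")
    case False
    then have "y < x" using less.prems(2) by simp
    note below = predecessor_less[OF chain this]
    have "level (f x) \<le> level (f (predecessor x)) + 1"
      using f below level_predecessor[OF chain \<open>y < x\<close>] by (auto simp: carrier_F_monoid_iff)
    then have "level (predecessor x) \<le> level (f (predecessor x))"
      using level_predecessor[OF chain \<open>y < x\<close>] less.prems(1) by simp
    then have "f (predecessor x) = predecessor x"
      using F_monoid_le[OF f] level_strict_mono by (metis leD order.order_iff_strict)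
    then show ?thesis
      using less.hyps level_strict_mono[OF below] le_predecessor[OF \<open>y < x\<close>] by blast
  qed (use less.prems in simp)
qed

lemma F_monoid_fixed_points_nested:
  fixes f g :: "'a::{finite, lattice} \<Rightarrow> 'a"
  assumes chain: "Complete_Partial_Order.chain (\<le>) (UNIV :: 'a set)"
    and "f \<in> carrier F_monoid" "g \<in> carrier F_monoid"
  shows "{x. f x = x} \<subseteq> {x. g x = x} \<or> {x. g x = x} \<subseteq> {x. f x = x}"
proof (rule ccontr)
  assume "\<not> ?thesis"
  then obtain x y where "f x = x" "g x \<noteq> x" "g y = y" "f y \<noteq> y" by auto
  moreover have "x \<le> y \<or> y \<le> x"
    using chain by (simp add: Complete_Partial_Order.chain_def)
  ultimately show False
    using F_monoid_fixed_points_downward_closed[OF chain] assms(2,3) by blast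
qed

lemma three_element_principal_right_comparable:
  fixes f g :: "'a::{finite, order} \<Rightarrow> 'a"
  assumes UNIV: "{p, q, r} = (UNIV :: 'a set)" and "p < q" "q < r"
    and f: "f \<in> carrier F_monoid" and g: "g \<in> carrier F_monoid"
    and f_eq: "f r = q" "f q = p" and g_eq: "g r \<noteq> r" "g q = p"
  shows "f \<in> principal_right F_monoid g \<or> g \<in> principal_right F_monoid f"
proof -
  have elements: "z \<in> {p, q, r}" for z
    using UNIV by simp
  have "z = p" if "z \<le> p" for z
    using that elements[of z] \<open>p < q\<close> \<open>q < r\<close> by auto
  then have p: "f p = p" "g p = p"
    using F_monoid_le f g by blast+
  consider (equal) "g r = q" | (least) "g r = p"
    using elements[of "g r"] g_eq(1) by auto
  then show ?thesis
  proof cases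
    case equal
    have "f z = g z" for z
      using elements[of z] p f_eq g_eq(2) equal by auto
    then have "f = g" by (rule ext)
    then show ?thesis using monoid.principal_right_self[OF monoid_F_monoid f] by simp
  next
    case least
    have "(f \<circ> g) z = g z" for z
      using elements[of z] p g_eq(2) least by auto
    then have "f \<circ> g = g" by (rule ext)
    then show ?thesis using principal_right_F_monoid_absorb[OF g] by blast
  qed
qed

lemma short_chain_principal_right_comparable:
  fixes f g :: "'a::{finite, lattice} \<Rightarrow> 'a"
  assumes chain: "Complete_Partial_Order.chain (\<le>) (UNIV :: 'a set)"
    and card: "card (UNIV :: 'a set) \<le> 3"
    and f: "f \<in> carrier F_monoid" and g: "g \<in> carrier F_monoid"
    and fixed: "{x. f x = x} \<subseteq> {x. g x = x}"
  shows "f \<in> principal_right F_monoid g \<or> g \<in> principal_right F_monoid f"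
proof (cases "g \<circ> f = f")
  case True
  then show ?thesis using principal_right_F_monoid_absorb[OF f] by blast
next
  case False
  then obtain r where g_moves: "g (f r) \<noteq> f r" by (auto simp: fun_eq_iff)
  then have f_moves: "f (f r) \<noteq> f r" "f r \<noteq> r" using fixed by auto
  have less: "g (f r) < f r" "f r < r"
    using g_moves f_moves(2) F_monoid_le[OF g, of "f r"] F_monoid_le[OF f, of r] by simp_all
  have "g (f r) \<noteq> r" using less by auto
  then have UNIV: "{g (f r), f r, r} = UNIV"
    using card g_moves f_moves(2) by (intro card_seteq) (simp_all add: card_insert_if)
  have "f (f r) \<in> {g (f r), f r, r}" unfolding UNIV ..
  then have "f (f r) = g (f r)"
    using f_moves F_monoid_le[OF f, of "f r"] less(2) by auto
  moreover have "g r \<noteq> r"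
    using F_monoid_fixed_points_downward_closed[OF chain g, of r "f r"] less(2) g_moves by (meson less_imp_le)
  ultimately show ?thesis
    by (intro three_element_principal_right_comparable[OF UNIV less f g]) simp_all
qed

lemma short_chain_imp_chain_X_poset:
  assumes "Complete_Partial_Order.chain (\<le>) (UNIV :: 'a::{finite, lattice} set)"
    and "card (UNIV :: 'a set) \<le> 3"
  shows "Complete_Partial_Order.chain (\<subseteq>) (X_poset (F_monoid :: ('a \<Rightarrow> 'a) monoid))"
  unfolding monoid.chain_X_poset_iff[OF monoid_F_monoid]
proof (intro ballI)
  fix f g :: "'a \<Rightarrow> 'a"
  assume carrier: "f \<in> carrier F_monoid" "g \<in> carrier F_monoid"
  from F_monoid_fixed_points_nested[OF assms(1) carrier]
  show "f \<in> principal_right F_monoid g \<or> g \<in> principal_right F_monoid f"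
  proof
    assume "{x. f x = x} \<subseteq> {x. g x = x}"
    with assms carrier show ?thesis by (rule short_chain_principal_right_comparable)
  next
    assume "{x. g x = x} \<subseteq> {x. f x = x}"
    with assms carrier(2,1) have "g \<in> principal_right F_monoid f \<or> f \<in> principal_right F_monoid g"
      by (rule short_chain_principal_right_comparable)
    then show ?thesis by blast
  qed
qed

theorem theorem3p8:
  shows "Complete_Partial_Order.chain (\<subseteq>) (X_poset (F_monoid :: ('a::{finite, lattice} \<Rightarrow> 'a) monoid)) \<longleftrightarrow>
    Complete_Partial_Order.chain (\<le>) (UNIV :: 'a set) \<and> card (UNIV :: 'a set) \<in> {1, 2, 3}"
proof -
  have "n \<in> {1, 2, 3} \<longleftrightarrow> n \<le> 3" if "0 < n" for n :: nat
    using that by auto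
  then have "card (UNIV :: 'a set) \<in> {1, 2, 3} \<longleftrightarrow> card (UNIV :: 'a set) \<le> 3"
    by (simp only: finite_UNIV_card_ge_0 finite)
  then show ?thesis
    using chain_X_poset_imp_chain chain_X_poset_imp_card_le_3 short_chain_imp_chain_X_poset
    by blast
qed

end
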